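(* There exists an infinite sequence $(G_k)_{k\ge 0}$ of pairwise non-isomorphic graphs such that, writing $\beta_k=|K(G_k)|/|V(G_k)|$ for the proportion of good vertices of $G_k$ (so that $\beta_k>0$ and $G_k$ is a $\beta_k$-Kirchhoff Šoltés graph), one has $\lim_{k\to\infty}\beta_k=3-2\sqrt{2}$.
   Context: All graphs are finite, simple, undirected and connected. For vertices $a,b$ of a connected graph $G$, the resistance distance $\Omega_G(a,b)$ is the effective resistance between $a$ and $b$ in the electrical network obtained from $G$ by replacing each edge by a unit resistor; equivalently $\Omega_G(a,b)=(e_a-e_b)^{T}L^{\dagger}(e_a-e_b)$, where $L$ is the Laplacian matrix of $G$, $L^{\dagger}$ its Moore–Penrose inverse, and $e_a$ the standard unit vector indexed by $a$. The Kirchhoff index of a connected graph $G$ is $Kf(G)=\sum_{\{u,v\}\subseteq V(G)}\Omega_G(u,v)$, the sum over unordered pairs of distinct vertices. $G-v$ denotes the graph obtained from $G$ by deleting the vertex $v$ and its incident edges. A vertex $v$ of $G$ is good if $G-v$ is connected and $Kf(G)=Kf(G-v)$ (cut vertices are not good). $K(G)$ denotes the set of good vertices of $G$. For a rational $\beta\in(0,1]$, $G$ is a $\beta$-Kirchhoff Šoltés graph if $|K(G)|\ge\beta|V(G)|$. *)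

theory Defs
  imports Complex_Main "Graph_Theory.Graph_Theory"
begin

text \<open>
  A finite simple undirected graph is an element of the locale \<^locale>\<open>graph\<close>: a finite, loop-free
  digraph without parallel arcs and with a symmetric arc relation, so that an edge
  is a pair of opposite arcs. The constant \<open>connected\<close> below is the one for digraphs, not the
  topological one; it is false for the graph without vertices.
\<close>

definition connected_graph :: "('a, 'b) pre_digraph \<Rightarrow> bool" where
  "connected_graph G \<longleftrightarrow> graph G \<and> Digraph_Component.connected G"

text \<open>
  Real matrices with rows and columns indexed by a finite set \<open>V\<close> are functions of two arguments;
  only the entries with both indices in \<open>V\<close> matter.
\<close>

definition mat_mult ::
  "'a set \<Rightarrow> ('a \<Rightarrow> 'a \<Rightarrow> real) \<Rightarrow> ('a \<Rightarrow> 'a \<Rightarrow> real) \<Rightarrow> ('a \<Rightarrow> 'a \<Rightarrow> real)" where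
  "mat_mult V A B = (\<lambda>u w. \<Sum>x\<in>V. A u x * B x w)"

definition mat_eq :: "'a set \<Rightarrow> ('a \<Rightarrow> 'a \<Rightarrow> real) \<Rightarrow> ('a \<Rightarrow> 'a \<Rightarrow> real) \<Rightarrow> bool" where
  "mat_eq V A B \<longleftrightarrow> (\<forall>u\<in>V. \<forall>w\<in>V. A u w = B u w)"

definition mat_symmetric :: "'a set \<Rightarrow> ('a \<Rightarrow> 'a \<Rightarrow> real) \<Rightarrow> bool" where
  "mat_symmetric V A \<longleftrightarrow> (\<forall>u\<in>V. \<forall>w\<in>V. A u w = A w u)"

text \<open>
  The four Penrose equations. The last conjunct normalises the irrelevant entries to zero, which
  makes the pseudoinverse unique as a function.
\<close>

definition is_moore_penrose ::
  "'a set \<Rightarrow> ('a \<Rightarrow> 'a \<Rightarrow> real) \<Rightarrow> ('a \<Rightarrow> 'a \<Rightarrow> real) \<Rightarrow> bool" where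
  "is_moore_penrose V A X \<longleftrightarrow>
     mat_eq V (mat_mult V (mat_mult V A X) A) A \<and>
     mat_eq V (mat_mult V (mat_mult V X A) X) X \<and>
     mat_symmetric V (mat_mult V A X) \<and>
     mat_symmetric V (mat_mult V X A) \<and>
     (\<forall>u w. \<not> (u \<in> V \<and> w \<in> V) \<longrightarrow> X u w = 0)"

definition moore_penrose :: "'a set \<Rightarrow> ('a \<Rightarrow> 'a \<Rightarrow> real) \<Rightarrow> ('a \<Rightarrow> 'a \<Rightarrow> real)" where
  "moore_penrose V A = (THE X. is_moore_penrose V A X)"

definition laplacian :: "('a, 'b) pre_digraph \<Rightarrow> 'a \<Rightarrow> 'a \<Rightarrow> real" where
  "laplacian G u w =
     (if u = w then real (out_degree G u) else if (u, w) \<in> arcs_ends G then - 1 else 0)"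

definition unit_vector :: "'a \<Rightarrow> 'a \<Rightarrow> real" where
  "unit_vector a = (\<lambda>w. if w = a then 1 else 0)"

definition resistance_distance :: "('a, 'b) pre_digraph \<Rightarrow> 'a \<Rightarrow> 'a \<Rightarrow> real" where
  "resistance_distance G a b =
     (\<Sum>u\<in>verts G. \<Sum>w\<in>verts G.
        (unit_vector a u - unit_vector b u)
        * moore_penrose (verts G) (laplacian G) u w
        * (unit_vector a w - unit_vector b w))"

text \<open>
  The double sum runs over ordered pairs of distinct vertices, and the resistance distance is
  symmetric by its definition as a quadratic form; hence the factor one half for unordered pairs.
\<close>

definition kirchhoff_index :: "('a, 'b) pre_digraph \<Rightarrow> real" where
  "kirchhoff_index G =
     (\<Sum>u\<in>verts G. \<Sum>v\<in>verts G - {u}. resistance_distance G u v) / 2"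

definition good_vertex :: "('a, 'b) pre_digraph \<Rightarrow> 'a \<Rightarrow> bool" where
  "good_vertex G v \<longleftrightarrow>
     v \<in> verts G \<and>
     Digraph_Component.connected (pre_digraph.del_vert G v) \<and>
     kirchhoff_index G = kirchhoff_index (pre_digraph.del_vert G v)"

definition good_vertices :: "('a, 'b) pre_digraph \<Rightarrow> 'a set" where
  "good_vertices G = {v. good_vertex G v}"

definition kirchhoff_soltes :: "real \<Rightarrow> ('a, 'b) pre_digraph \<Rightarrow> bool" where
  "kirchhoff_soltes \<beta> G \<longleftrightarrow>
     \<beta> \<in> \<rat> \<and> 0 < \<beta> \<and> \<beta> \<le> 1 \<and> connected_graph G \<and>
     real (card (good_vertices G)) \<ge> \<beta> * real (card (verts G))"

end

theory Submission
  imports Defs "HOL-Library.Countable" "HOL-Real_Asymp.Real_Asymp"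
begin

text \<open>
  If \<open>g\<close> is the inverse of the Laplacian with one vertex grounded (a Green function), then
  \<open>\<Omega>(a,b) = g(a,a) + g(b,b) - 2 g(a,b)\<close>, so the Kirchhoff index of a graph on \<open>N\<close> vertices is
  \<open>N tr g\<close> minus the sum of all entries of \<open>g\<close>.

  In a four-cycle through a hub whose vertex opposite the hub carries a pendant vertex, deleting a
  neighbour of the hub raises the trace of the hub-grounded Green function by \<open>3/2\<close> and the sum of
  its entries by \<open>3\<close>; the Kirchhoff index is then unchanged if and only if the trace is
  \<open>(3N - 9)/2\<close>. Glue \<open>k\<close> such cycles at the hub and add \<open>s\<close> leaves at the hub and a star with \<open>m\<close>
  leaves whose centre is joined to the hub. The condition becomes \<open>m = s + 3k - 5\<close>, and all other
  vertices are leaves or cut vertices, which are not good. The proportion of good vertices is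
  therefore \<open>2k / (7k + 2s - 3)\<close>, which tends to \<open>3 - 2\<surd>2\<close> when \<open>s/k\<close> tends to \<open>2\<surd>2 - 1/2\<close>.
\<close>

section \<open>Moore-Penrose inverses from a grounded Green function\<close>

text \<open>Transposing \<open>A X = (A Y)(A X)\<close>, whose factors are symmetric, gives
  \<open>A X = (A X)(A Y) = A Y\<close>; likewise \<open>X A = Y A\<close>. Then
  \<open>X = X A X = Y A X = Y A Y = Y\<close>. All this holds up to \<open>mat_eq\<close>; outside
  \<open>V\<close> both functions vanish by the normalisation.\<close>

lemma moore_penrose_unique:
  assumes X: "is_moore_penrose V A X" and Y: "is_moore_penrose V A Y"
  shows "X = Y"
proof (intro ext)
  fix u w
  let ?m = "mat_mult V"
  have assoc: "?m (?m P Q) R = ?m P (?m Q R)" for P Q R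
    unfolding mat_mult_def
    by (intro ext) (simp add: sum_distrib_left sum_distrib_right mult.assoc, subst sum.swap, simp)
  have cong: "?m P Q a b = ?m P' Q' a b"
    if "mat_eq V P P'" "mat_eq V Q Q'" "a \<in> V" "b \<in> V" for P P' Q Q' a b
    using that unfolding mat_mult_def mat_eq_def by (intro sum.cong) auto
  have congE: "mat_eq V (?m P Q) (?m P' Q')" if "mat_eq V P P'" "mat_eq V Q Q'" for P P' Q Q'
    using cong[OF that] unfolding mat_eq_def by blast
  have refl: "mat_eq V P P" for P by (simp add: mat_eq_def)
  have sym: "mat_eq V P Q \<Longrightarrow> mat_eq V Q P" for P Q by (simp add: mat_eq_def)
  have trans: "mat_eq V P Q \<Longrightarrow> mat_eq V Q R \<Longrightarrow> mat_eq V P R" for P Q R by (simp add: mat_eq_def)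
  define t :: "('a \<Rightarrow> 'a \<Rightarrow> real) \<Rightarrow> 'a \<Rightarrow> 'a \<Rightarrow> real" where "t P = (\<lambda>a b. P b a)" for P
  have t_mult: "t (?m P Q) = ?m (t Q) (t P)" for P Q
    by (simp add: t_def mat_mult_def mult.commute)
  have t_cong: "mat_eq V P Q \<Longrightarrow> mat_eq V (t P) (t Q)" for P Q by (simp add: t_def mat_eq_def)
  have symm: "mat_symmetric V P \<longleftrightarrow> mat_eq V (t P) P" for P
    by (auto simp: t_def mat_eq_def mat_symmetric_def)
  have X': "mat_eq V (?m (?m A X) A) A" "mat_eq V (?m (?m X A) X) X"
      "mat_eq V (t (?m A X)) (?m A X)" "mat_eq V (t (?m X A)) (?m X A)"
    and Y': "mat_eq V (?m (?m A Y) A) A" "mat_eq V (?m (?m Y A) Y) Y"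
      "mat_eq V (t (?m A Y)) (?m A Y)" "mat_eq V (t (?m Y A)) (?m Y A)"
    using X Y unfolding is_moore_penrose_def symm by auto
  have "mat_eq V (?m A X) (?m (?m A Y) (?m A X))"
    using congE[OF Y'(1) refl[of X]] sym by (simp add: assoc)
  hence "mat_eq V (t (?m A X)) (t (?m (?m A Y) (?m A X)))" by (rule t_cong)
  hence "mat_eq V (?m A X) (?m (?m A X) (?m A Y))"
    using congE[OF X'(3) Y'(3)] X'(3) trans sym unfolding t_mult[of "?m A Y"] by blast
  moreover have "mat_eq V (?m (?m A X) (?m A Y)) (?m A Y)"
    using congE[OF X'(1) refl[of Y]] by (simp add: assoc)
  ultimately have AX: "mat_eq V (?m A X) (?m A Y)" by (rule trans)
  have "mat_eq V (?m X A) (?m (?m X A) (?m Y A))"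
    using congE[OF refl[of X] Y'(1)] sym by (simp add: assoc)
  hence "mat_eq V (t (?m X A)) (t (?m (?m X A) (?m Y A)))" by (rule t_cong)
  hence "mat_eq V (?m X A) (?m (?m Y A) (?m X A))"
    using congE[OF Y'(4) X'(4)] X'(4) trans sym unfolding t_mult[of "?m X A"] by blast
  moreover have "mat_eq V (?m (?m Y A) (?m X A)) (?m Y A)"
    using congE[OF refl[of Y] X'(1)] by (simp add: assoc)
  ultimately have XA: "mat_eq V (?m X A) (?m Y A)" by (rule trans)
  have "mat_eq V X (?m (?m X A) X)" using X'(2) sym by blast
  also have "mat_eq V (?m (?m X A) X) (?m (?m Y A) X)" using congE[OF XA refl] .
  finally (trans) have "mat_eq V X (?m Y (?m A X))" by (simp add: assoc)
  also have "mat_eq V (?m Y (?m A X)) (?m (?m Y A) Y)" using congE[OF refl AX] by (simp add: assoc)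
  finally (trans) have "mat_eq V X Y" using Y'(2) trans by blast
  thus "X u w = Y u w"
    using X Y unfolding is_moore_penrose_def mat_eq_def by metis
qed

lemma moore_penrose_eqI: "is_moore_penrose V A X \<Longrightarrow> moore_penrose V A = X"
  unfolding moore_penrose_def using moore_penrose_unique by blast

text \<open>
  With \<open>P = I - J/n\<close> the pseudoinverse is \<open>P g P\<close>, and the quadratic form of \<open>P g P\<close> at
  \<open>e\<^sub>a - e\<^sub>b\<close> is that of \<open>g\<close>. The row of \<open>A g\<close> at the grounded index \<open>c\<close> need not be
  assumed, since the columns of \<open>A\<close> sum to zero.
\<close>

lemma moore_penrose_grounded:
  fixes A g :: "'a \<Rightarrow> 'a \<Rightarrow> real"
  assumes fin: "finite V" and c: "c \<in> V"
    and symA: "\<And>u w. u \<in> V \<Longrightarrow> w \<in> V \<Longrightarrow> A u w = A w u"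
    and rowA: "\<And>u. u \<in> V \<Longrightarrow> (\<Sum>z\<in>V. A u z) = 0"
    and symg: "\<And>u w. u \<in> V \<Longrightarrow> w \<in> V \<Longrightarrow> g u w = g w u"
    and Ag: "\<And>u w. u \<in> V \<Longrightarrow> w \<in> V \<Longrightarrow> u \<noteq> c \<Longrightarrow> (\<Sum>z\<in>V. A u z * g z w) = of_bool (u = w)"
    and a: "a \<in> V" and b: "b \<in> V"
  shows "(\<Sum>u\<in>V. \<Sum>w\<in>V. (unit_vector a u - unit_vector b u) * moore_penrose V A u w
      * (unit_vector a w - unit_vector b w)) = g a a + g b b - 2 * g a b"
proof -
  define n where "n = real (card V)"
  have n: "n > 0" using fin c unfolding n_def by (auto simp: card_gt_0_iff)
  \<comment> \<open>\<open>r\<close> holds the row means of \<open>g\<close> and \<open>m\<close>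
    the mean of all entries, so \<open>X\<close> is \<open>P g P\<close> written out
    entrywise.\<close>
  define r where "r u = (\<Sum>w\<in>V. g u w) / n" for u
  define m where "m = (\<Sum>u\<in>V. r u) / n"
  define X where "X u w = (if u \<in> V \<and> w \<in> V then g u w - r u - r w + m else 0)" for u w
  have colA: "(\<Sum>u\<in>V. A u z) = 0" if "z \<in> V" for z
    using rowA[OF that] symA that by (metis (no_types, lifting) sum.cong)
  have Agc: "(\<Sum>z\<in>V. A u z * g z w) = of_bool (u = w) - of_bool (u = c)"
    if uw: "u \<in> V" "w \<in> V" for u w
  proof (cases "u = c")
    case True
    have "0 = (\<Sum>z\<in>V. (\<Sum>u\<in>V. A u z) * g z w)" using colA by simp
    also have "\<dots> = (\<Sum>u\<in>V. \<Sum>z\<in>V. A u z * g z w)"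
      by (simp add: sum_distrib_right) (rule sum.swap)
    also have "\<dots> = (\<Sum>z\<in>V. A c z * g z w) + (\<Sum>u\<in>V-{c}. \<Sum>z\<in>V. A u z * g z w)"
      using fin c by (rule sum.remove)
    also have "(\<Sum>u\<in>V-{c}. \<Sum>z\<in>V. A u z * g z w) = (\<Sum>u\<in>V-{c}. of_bool (u = w))"
      using Ag uw by (intro sum.cong) auto
    also have "\<dots> = of_bool (w \<noteq> c)"
      using fin uw by (simp add: of_bool_def)
    finally show ?thesis using True by (auto simp: of_bool_def split: if_splits)
  qed (use Ag uw in auto)
  \<comment> \<open>\<open>P\<close> is the orthogonal projection onto the complement of the
    constants. Once \<open>A X\<close> and \<open>X A\<close> equal \<open>P\<close>, the first two
    Penrose equations reduce to \<open>P A = A\<close> and \<open>P X = X\<close>, which hold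
    because the columns of \<open>A\<close> and of \<open>X\<close> sum to zero.\<close>
  define P :: "'a \<Rightarrow> 'a \<Rightarrow> real" where "P u w = of_bool (u = w) - 1 / n" for u w
  have AX: "(\<Sum>z\<in>V. A u z * X z w) = P u w" if uw: "u \<in> V" "w \<in> V" for u w
  proof -
    have "(\<Sum>z\<in>V. A u z * r z) = (\<Sum>y\<in>V. \<Sum>z\<in>V. A u z * g z y) / n"
      unfolding r_def sum_divide_distrib sum_distrib_left by (subst sum.swap) simp
    also have "\<dots> = (\<Sum>y\<in>V. of_bool (u = y) - of_bool (u = c)) / n"
      using Agc uw by simp
    also have "\<dots> = 1 / n - of_bool (u = c)"
      using fin uw n by (auto simp: sum_subtractf of_bool_def n_def diff_divide_distrib)
    finally have 1: "(\<Sum>z\<in>V. A u z * r z) = 1 / n - of_bool (u = c)" .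
    have "(\<Sum>z\<in>V. A u z * X z w) = (\<Sum>z\<in>V. A u z * g z w - A u z * r z + (m - r w) * A u z)"
      using uw by (intro sum.cong) (auto simp: X_def algebra_simps)
    also have "\<dots> = (\<Sum>z\<in>V. A u z * g z w) - (\<Sum>z\<in>V. A u z * r z)"
      using rowA uw by (simp add: sum.distrib sum_subtractf flip: sum_distrib_left)
    finally show ?thesis using 1 Agc uw by (simp add: P_def)
  qed
  have symX: "X u w = X w u" for u w using symg by (auto simp: X_def)
  have XA: "(\<Sum>z\<in>V. X u z * A z w) = P u w" if uw: "u \<in> V" "w \<in> V" for u w
  proof -
    have "(\<Sum>z\<in>V. X u z * A z w) = (\<Sum>z\<in>V. A w z * X z u)"
      using uw symA symX by (intro sum.cong) (auto simp: mult.commute)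
    thus ?thesis using AX[OF uw(2,1)] by (auto simp: P_def)
  qed
  have X0: "(\<Sum>z\<in>V. X z w) = 0" if w: "w \<in> V" for w
  proof -
    have "(\<Sum>z\<in>V. X z w) = (\<Sum>z\<in>V. g w z) - (\<Sum>z\<in>V. r z) + n * (m - r w)"
      using w symg by (simp add: X_def sum.distrib sum_subtractf n_def algebra_simps cong: sum.cong)
    also have "\<dots> = 0" using n by (simp add: r_def m_def field_simps)
    finally show ?thesis .
  qed
  have PF: "(\<Sum>z\<in>V. P u z * F z w) = F u w - (\<Sum>z\<in>V. F z w) / n"
    if "u \<in> V" for u w and F :: "'a \<Rightarrow> 'a \<Rightarrow> real"
  proof -
    have "(\<Sum>z\<in>V. P u z * F z w) = (\<Sum>z\<in>V. (if u = z then F z w else 0) - F z w / n)"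
      by (intro sum.cong) (auto simp: P_def algebra_simps)
    thus ?thesis using fin that by (simp add: sum_subtractf sum_divide_distrib)
  qed
  have "is_moore_penrose V A X"
    unfolding is_moore_penrose_def
  proof (intro conjI)
    show "mat_eq V (mat_mult V (mat_mult V A X) A) A"
      unfolding mat_eq_def mat_mult_def using AX PF[of _ A] colA by simp
    show "mat_eq V (mat_mult V (mat_mult V X A) X) X"
      unfolding mat_eq_def mat_mult_def using XA PF[of _ X] X0 by simp
    show "mat_symmetric V (mat_mult V A X)" "mat_symmetric V (mat_mult V X A)"
      unfolding mat_symmetric_def mat_mult_def using AX XA by (auto simp: P_def)
  qed (auto simp: X_def)
  hence mp: "moore_penrose V A = X" by (rule moore_penrose_eqI)
  have eval: "(\<Sum>w\<in>V. f w * (unit_vector a w - unit_vector b w)) = f a - f b"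
    for f :: "'a \<Rightarrow> real"
  proof -
    have "(\<Sum>w\<in>V. f w * (unit_vector a w - unit_vector b w))
        = (\<Sum>w\<in>V. (if w = a then f w else 0) - (if w = b then f w else 0))"
      by (intro sum.cong) (auto simp: unit_vector_def)
    thus ?thesis using fin a b by (simp add: sum_subtractf)
  qed
  have "(\<Sum>u\<in>V. \<Sum>w\<in>V. (unit_vector a u - unit_vector b u) * X u w
      * (unit_vector a w - unit_vector b w))
    = (\<Sum>u\<in>V. (X u a - X u b) * (unit_vector a u - unit_vector b u))"
    unfolding eval[of "\<lambda>w. (unit_vector a _ - unit_vector b _) * X _ w"]
    by (simp add: algebra_simps)
  also have "\<dots> = X a a - X a b - (X b a - X b b)" by (rule eval)
  also have "\<dots> = g a a + g b b - 2 * g a b"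
    using a b symg[OF b a] by (simp add: X_def)
  finally show ?thesis unfolding mp .
qed

section \<open>Graphs over countable types, encoded in the natural numbers\<close>

text \<open>The encoding by \<open>to_nat\<close> yields the vertex type of the theorem while the
  graphs themselves are described over a datatype. The relation \<open>adj\<close> is cut down to
  \<open>V\<close> here, so deleting a vertex only shrinks \<open>V\<close>.\<close>

definition graph_of :: "'a::countable set \<Rightarrow> ('a \<Rightarrow> 'a \<Rightarrow> bool) \<Rightarrow> (nat, nat \<times> nat) pre_digraph" where
  "graph_of V adj = \<lparr>verts = to_nat ` V,
     arcs = {(to_nat u, to_nat w) | u w. u \<in> V \<and> w \<in> V \<and> adj u w}, tail = fst, head = snd\<rparr>"

lemma verts_graph_of [simp]: "verts (graph_of V adj) = to_nat ` V"
  by (simp add: graph_of_def)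

lemma to_nat_mem_iff [simp]: "to_nat u \<in> to_nat ` V \<longleftrightarrow> u \<in> V"
  by auto

lemma arcs_ends_graph_of:
  "(to_nat u, to_nat w) \<in> arcs_ends (graph_of V adj) \<longleftrightarrow> u \<in> V \<and> w \<in> V \<and> adj u w"
  by (force simp: graph_of_def arcs_ends_def arc_to_ends_def)

lemma del_vert_graph_of:
  "pre_digraph.del_vert (graph_of V adj) (to_nat v) = graph_of (V - {v}) adj"
  by (auto simp: graph_of_def pre_digraph.del_vert_def)

lemma out_degree_graph_of:
  assumes "u \<in> V"
  shows "out_degree (graph_of V adj) (to_nat u) = card {w \<in> V. adj u w}"
proof -
  have "out_arcs (graph_of V adj) (to_nat u) = (\<lambda>w. (to_nat u, to_nat w)) ` {w \<in> V. adj u w}"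
    using assms by (auto simp: out_arcs_def graph_of_def)
  moreover have "inj_on (\<lambda>w. (to_nat u, to_nat w)) {w \<in> V. adj u w}"
    by (auto simp: inj_on_def)
  ultimately show ?thesis by (simp add: out_degree_def card_image)
qed

lemma graph_graph_of:
  assumes fin: "finite V" and sym: "symp adj" and irr: "\<And>u. \<not> adj u u"
  shows "graph (graph_of V adj)"
proof -
  have "arcs (graph_of V adj) \<subseteq> to_nat ` V \<times> to_nat ` V" by (auto simp: graph_of_def)
  hence "finite (arcs (graph_of V adj))" using fin by (meson finite_SigmaI finite_imageI finite_subset)
  thus ?thesis
    using fin irr sympD[OF sym]
    by unfold_locales
      (fastforce simp: graph_of_def arc_to_ends_def symmetric_conv)+
qed

lemma connected_graph_of_iff:
  assumes "finite V" "symp adj" "\<And>u. \<not> adj u u"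
  shows "Digraph_Component.connected (graph_of V adj) \<longleftrightarrow> strongly_connected (graph_of V adj)"
proof -
  interpret graph "graph_of V adj" using assms by (rule graph_graph_of)
  show ?thesis
    unfolding connected_def strongly_connected_def
    using reachable_mk_symmetric_eq[OF sym_arcs] by simp
qed

text \<open>Descending along \<open>rank\<close> leads from every vertex to \<open>c\<close>;
  symmetry supplies the way back.\<close>

lemma connected_graph_ofI:
  fixes rank :: "'a::countable \<Rightarrow> nat"
  assumes g: "finite V" "symp adj" "\<And>u. \<not> adj u u" and c: "c \<in> V"
    and step: "\<And>u. u \<in> V \<Longrightarrow> u \<noteq> c \<Longrightarrow> \<exists>z\<in>V. adj u z \<and> rank z < rank u"
  shows "Digraph_Component.connected (graph_of V adj)"
proof -
  interpret graph "graph_of V adj" using g by (rule graph_graph_of)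
  have to_c: "to_nat u \<rightarrow>\<^sup>*\<^bsub>graph_of V adj\<^esub> to_nat c" if "u \<in> V" for u
    using that
  proof (induction "rank u" arbitrary: u rule: less_induct)
    case less
    show ?case
    proof (cases "u = c")
      case False
      then obtain z where "z \<in> V" "adj u z" "rank z < rank u" using step less.prems by blast
      moreover from this have "(to_nat u, to_nat z) \<in> arcs_ends (graph_of V adj)"
        using less.prems by (simp add: arcs_ends_graph_of)
      ultimately show ?thesis using less.hyps adj_reachable_trans by blast
    qed (use c in auto)
  qed
  have "strongly_connected (graph_of V adj)"
    unfolding strongly_connected_def
  proof (intro conjI ballI)
    show "verts (graph_of V adj) \<noteq> {}" using c by auto
    fix x y assume "x \<in> verts (graph_of V adj)" "y \<in> verts (graph_of V adj)"
    then obtain u w where "x = to_nat u" "u \<in> V" "y = to_nat w" "w \<in> V" by auto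
    thus "x \<rightarrow>\<^sup>*\<^bsub>graph_of V adj\<^esub> y"
      using reachable_trans[OF to_c[of u] symmetric_reachable[OF sym_arcs to_c[of w]]] by simp
  qed
  thus ?thesis using connected_graph_of_iff g by blast
qed

text \<open>No walk starting in \<open>U\<close> leaves \<open>U\<close>. The set \<open>U\<close>
  may reach beyond \<open>V\<close>, so the whole range of a constructor can serve as
  \<open>U\<close>.\<close>

lemma not_connected_graph_ofI:
  assumes g: "finite V" "symp adj" "\<And>u. \<not> adj u u"
    and a: "a \<in> U" "a \<in> V" and b: "b \<in> V" "b \<notin> U"
    and closed: "\<And>u z. u \<in> U \<Longrightarrow> z \<in> V \<Longrightarrow> adj u z \<Longrightarrow> z \<in> U"
  shows "\<not> Digraph_Component.connected (graph_of V adj)"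
proof
  assume "Digraph_Component.connected (graph_of V adj)"
  hence "strongly_connected (graph_of V adj)" using connected_graph_of_iff g by blast
  hence "to_nat a \<rightarrow>\<^sup>*\<^bsub>graph_of V adj\<^esub> to_nat b"
    using a b unfolding strongly_connected_def by simp
  hence "(to_nat a, to_nat b) \<in> (arcs_ends (graph_of V adj))\<^sup>*" by (rule reachable_rtranclI)
  hence "to_nat b \<in> to_nat ` U"
  proof (induction rule: rtrancl_induct)
    case (step y z)
    moreover obtain u w where "y = to_nat u" "z = to_nat w" "w \<in> V" "adj u w"
      using step(2) by (auto simp: graph_of_def arcs_ends_def arc_to_ends_def)
    ultimately show ?case using closed by auto
  qed (use a in auto)
  thus False using b by auto
qed

text \<open>The sum of differences is the Laplacian at \<open>u\<close> applied to the column of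
  \<open>g\<close> at \<open>w\<close>. The value at \<open>c\<close> is left free: adding a
  constant to \<open>g\<close> changes neither the resistances nor the Kirchhoff index computed from
  it.\<close>

definition green_function ::
  "'a set \<Rightarrow> ('a \<Rightarrow> 'a \<Rightarrow> bool) \<Rightarrow> 'a \<Rightarrow> ('a \<Rightarrow> 'a \<Rightarrow> real) \<Rightarrow> bool" where
  "green_function V adj c g \<longleftrightarrow> c \<in> V \<and> (\<forall>u\<in>V. \<forall>w\<in>V. g u w = g w u) \<and>
     (\<forall>u\<in>V - {c}. \<forall>w\<in>V. (\<Sum>z | z \<in> V \<and> adj u z. g u w - g z w) = of_bool (u = w))"

lemma resistance_distance_green:
  assumes g: "finite V" "symp adj" "\<And>u. \<not> adj u u" and G: "green_function V adj c g"
    and a: "a \<in> V" and b: "b \<in> V"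
  shows "resistance_distance (graph_of V adj) (to_nat a) (to_nat b) = g a a + g b b - 2 * g a b"
proof -
  let ?L = "laplacian (graph_of V adj)"
  have L: "?L (to_nat u) (to_nat w)
      = (if u = w then real (card {z\<in>V. adj u z}) else if adj u w then -1 else 0)"
    if "u \<in> V" "w \<in> V" for u w
    using that by (simp add: laplacian_def out_degree_graph_of arcs_ends_graph_of)
  have row: "(\<Sum>z\<in>V. ?L (to_nat u) (to_nat z) * f z) = (\<Sum>z | z \<in> V \<and> adj u z. f u - f z)"
    if u: "u \<in> V" for u and f :: "'a \<Rightarrow> real"
  proof -
    have "(\<Sum>z\<in>V. ?L (to_nat u) (to_nat z) * f z)
        = (\<Sum>z\<in>V. (if u = z then real (card {z\<in>V. adj u z}) * f z else 0)
            - (if adj u z then f z else 0))"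
      using u g(3) by (intro sum.cong) (auto simp: L)
    also have "\<dots> = real (card {z\<in>V. adj u z}) * f u - (\<Sum>z\<in>V. if adj u z then f z else 0)"
      using u g(1) by (simp add: sum_subtractf)
    also have "\<dots> = (\<Sum>z | z \<in> V \<and> adj u z. f u - f z)"
      using g(1) by (simp add: sum_subtractf sum.If_cases Int_def)
    finally show ?thesis .
  qed
  \<comment> \<open>The resistance distance sums over encoded vertices, so \<open>g\<close> is
    transported to the naturals.\<close>
  define g' where "g' x y = g (from_nat x) (from_nat y)" for x y
  have inj: "inj_on to_nat V" by (rule inj_on_subset[OF inj_to_nat]) simp
  have "resistance_distance (graph_of V adj) (to_nat a) (to_nat b)
      = g' (to_nat a) (to_nat a) + g' (to_nat b) (to_nat b) - 2 * g' (to_nat a) (to_nat b)"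
    unfolding resistance_distance_def verts_graph_of
  proof (rule moore_penrose_grounded[where c = "to_nat c"], goal_cases)
    case (3 u w)
    thus ?case using sympD[OF g(2)] by (auto simp: L)
  next
    case (4 u)
    thus ?case using row[where f = "\<lambda>_. 1"] by (auto simp: sum.reindex[OF inj])
  next
    case (6 u w)
    then obtain u' w' where "u = to_nat u'" "w = to_nat w'" "u' \<in> V" "w' \<in> V" "u' \<noteq> c" by auto
    thus ?case using G row[of u' "\<lambda>z. g z w'"]
      by (simp add: sum.reindex[OF inj] g'_def green_function_def)
  qed (use g G a b in \<open>auto simp: green_function_def g'_def\<close>)
  thus ?thesis by (simp add: g'_def)
qed

lemma kirchhoff_index_green:
  assumes g: "finite V" "symp adj" "\<And>u. \<not> adj u u" and G: "green_function V adj c g"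
  shows "kirchhoff_index (graph_of V adj)
    = real (card V) * (\<Sum>u\<in>V. g u u) - (\<Sum>u\<in>V. \<Sum>w\<in>V. g u w)"
proof -
  have inj: "inj_on to_nat W" for W :: "'a set" by (rule inj_on_subset[OF inj_to_nat]) simp
  have inner: "(\<Sum>y\<in>to_nat ` V - {to_nat u}. resistance_distance (graph_of V adj) (to_nat u) y)
      = (\<Sum>w\<in>V. g u u + g w w - 2 * g u w)" if "u \<in> V" for u
  proof -
    have "to_nat ` V - {to_nat u} = to_nat ` (V - {u})" by auto
    hence "(\<Sum>y\<in>to_nat ` V - {to_nat u}. resistance_distance (graph_of V adj) (to_nat u) y)
        = (\<Sum>w\<in>V - {u}. resistance_distance (graph_of V adj) (to_nat u) (to_nat w))"
      by (simp add: sum.reindex[OF inj])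
    also have "\<dots> = (\<Sum>w\<in>V - {u}. g u u + g w w - 2 * g u w)"
      using resistance_distance_green[OF g G] that by (intro sum.cong) auto
    \<comment> \<open>The added term \<open>w = u\<close> is zero.\<close>
    also have "\<dots> = (\<Sum>w\<in>V. g u u + g w w - 2 * g u w)"
      using that g(1) by (simp add: sum.remove[of V u])
    finally show ?thesis .
  qed
  have "2 * kirchhoff_index (graph_of V adj) = (\<Sum>u\<in>V. \<Sum>w\<in>V. g u u + g w w - 2 * g u w)"
    unfolding kirchhoff_index_def verts_graph_of sum.reindex[OF inj] using inner by simp
  also have "\<dots> = 2 * (real (card V) * (\<Sum>u\<in>V. g u u) - (\<Sum>u\<in>V. \<Sum>w\<in>V. g u w))"
    by (simp add: sum.distrib sum_subtractf sum_distrib_left)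
  finally show ?thesis by simp
qed

text \<open>A leaf that is neither source nor ground carries no current, so it has the potential of
  its neighbour \<open>p\<close>. Its edge therefore contributes zero to the equation at
  \<open>p\<close>.\<close>

lemma green_function_delete_leaf:
  assumes fin: "finite V" and sym: "symp adj" and G: "green_function V adj c g"
    and l: "l \<in> V" "l \<noteq> c" and p: "{z. z \<in> V \<and> adj l z} = {p}" "p \<noteq> l"
  shows "green_function (V - {l}) adj c g"
proof -
  have lap: "(\<Sum>z | z \<in> V \<and> adj u z. g u w - g z w) = of_bool (u = w)"
    if "u \<in> V" "u \<noteq> c" "w \<in> V" for u w
    using G that unfolding green_function_def by blast
  have gl: "g l w = g p w" if "w \<in> V" "w \<noteq> l" for w
    using lap[of l w] l that unfolding p by simp
  have "(\<Sum>z | z \<in> V - {l} \<and> adj u z. g u w - g z w) = of_bool (u = w)"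
    if u: "u \<in> V" "u \<noteq> l" "u \<noteq> c" and w: "w \<in> V" "w \<noteq> l" for u w
  proof -
    have "(\<Sum>z | z \<in> V - {l} \<and> adj u z. g u w - g z w)
        = (\<Sum>z | z \<in> V \<and> adj u z. g u w - g z w)"
    proof (rule sum.mono_neutral_left)
      show "\<forall>z\<in>{z. z \<in> V \<and> adj u z} - {z. z \<in> V - {l} \<and> adj u z}. g u w - g z w = 0"
      proof
        fix z assume "z \<in> {z. z \<in> V \<and> adj u z} - {z. z \<in> V - {l} \<and> adj u z}"
        hence "z = l" "adj l u" using sympD[OF sym] by auto
        hence "z = l" "u = p" using u p by auto
        thus "g u w - g z w = 0" using gl w by simp
      qed
    qed (use fin in auto)
    thus ?thesis using lap u w by simp
  qed
  thus ?thesis using G l unfolding green_function_def by auto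
qed

text \<open>One function \<open>g\<close> serves both graphs, so only the row and column at
  \<open>l\<close> and the change of order matter. The formula serves to show that leaves are not
  good.\<close>

lemma kirchhoff_index_delete_leaf:
  assumes g: "finite V" "symp adj" "\<And>u. \<not> adj u u" and G: "green_function V adj c g"
    and l: "l \<in> V" "l \<noteq> c" and p: "{z. z \<in> V \<and> adj l z} = {p}"
  shows "kirchhoff_index (graph_of V adj) - kirchhoff_index (graph_of (V - {l}) adj)
    = (\<Sum>u\<in>V. g u u) + real (card V) * g l l - 2 * (\<Sum>w\<in>V. g l w)"
proof -
  have "p \<noteq> l" using p g(3) by auto
  hence G': "green_function (V - {l}) adj c g"
    using green_function_delete_leaf g G l p by metis
  have card: "real (card (V - {l})) = real (card V) - 1"
    using l(1) g(1) card_gt_0_iff[of V] by (auto simp: of_nat_diff)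
  have symg: "(\<Sum>u\<in>V. g u l) = (\<Sum>u\<in>V. g l u)"
    using G l unfolding green_function_def by (intro sum.cong) auto
  show ?thesis
    unfolding kirchhoff_index_green[OF g G] kirchhoff_index_green[OF finite_Diff[OF g(1)] g(2,3) G'] card
    using g(1) l(1) by (simp add: sum_diff1 sum_subtractf symg algebra_simps)
qed


section \<open>Cacti of four-cycles\<close>

text \<open>
  Each of \<open>k\<close> four-cycles \<open>Hub, Side i False, Far i, Side i True\<close> carries a pendant vertex
  \<open>Tip i\<close> at \<open>Far i\<close>. Moreover the hub carries \<open>s\<close> leaves \<open>Twig j\<close> and a neighbour \<open>Stem\<close> with
  \<open>m\<close> leaves \<open>Bud j\<close>.
\<close>

datatype vertex = Hub | Stem | Twig nat | Bud nat | Side nat bool | Far nat | Tip nat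

instance vertex :: countable by countable_datatype

fun child :: "vertex \<Rightarrow> vertex \<Rightarrow> bool" where
  "child Stem Hub = True"
| "child (Twig _) Hub = True"
| "child (Bud _) Stem = True"
| "child (Side _ _) Hub = True"
| "child (Far i) (Side j _) = (i = j)"
| "child (Tip i) (Far j) = (i = j)"
| "child _ _ = False"

definition adj :: "vertex \<Rightarrow> vertex \<Rightarrow> bool" where
  "adj u w \<longleftrightarrow> child u w \<or> child w u"

definition cactus :: "nat \<Rightarrow> nat \<Rightarrow> nat \<Rightarrow> vertex set" where
  "cactus k s m = {Hub} \<union> {Stem} \<union> Twig ` {..<s} \<union> Bud ` {..<m} \<union> (\<lambda>i. Side i False) ` {..<k}
     \<union> (\<lambda>i. Side i True) ` {..<k} \<union> Far ` {..<k} \<union> Tip ` {..<k}"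

fun depth :: "vertex \<Rightarrow> nat" where
  "depth Hub = 0"
| "depth (Far _) = 2"
| "depth (Bud _) = 2"
| "depth (Tip _) = 3"
| "depth _ = 1"

text \<open>
  The potential at \<open>u\<close> when a unit current enters at \<open>w\<close> and leaves at the hub. The predicate \<open>B\<close>
  marks the cycles from which one of the two vertices \<open>Side i b\<close> has been deleted.
\<close>

fun green :: "(nat \<Rightarrow> bool) \<Rightarrow> vertex \<Rightarrow> vertex \<Rightarrow> real" where
  "green B Stem Stem = 1"
| "green B Stem (Bud _) = 1"
| "green B (Bud _) Stem = 1"
| "green B (Bud i) (Bud j) = 1 + (if i = j then 1 else 0)"
| "green B (Twig i) (Twig j) = (if i = j then 1 else 0)"
| "green B (Side i b) (Side j c) = (if i = j then if B i then 1 else if b = c then 3/4 else 1/4 else 0)"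
| "green B (Side i b) (Far j) = (if i = j then if B i then 1 else 1/2 else 0)"
| "green B (Side i b) (Tip j) = (if i = j then if B i then 1 else 1/2 else 0)"
| "green B (Far i) (Side j b) = (if i = j then if B i then 1 else 1/2 else 0)"
| "green B (Tip i) (Side j b) = (if i = j then if B i then 1 else 1/2 else 0)"
| "green B (Far i) (Far j) = (if i = j then if B i then 2 else 1 else 0)"
| "green B (Far i) (Tip j) = (if i = j then if B i then 2 else 1 else 0)"
| "green B (Tip i) (Far j) = (if i = j then if B i then 2 else 1 else 0)"
| "green B (Tip i) (Tip j) = (if i = j then if B i then 3 else 2 else 0)"
| "green B _ _ = 0"

lemma symp_adj: "symp adj"
  by (auto simp: symp_def adj_def)

lemma adj_irrefl: "\<not> adj u u"
  by (cases u) (auto simp: adj_def)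

lemma finite_cactus [simp]: "finite (cactus k s m)"
  by (simp add: cactus_def)

lemma mem_cactus [simp]:
  "Hub \<in> cactus k s m" "Stem \<in> cactus k s m"
  "Twig j \<in> cactus k s m \<longleftrightarrow> j < s" "Bud j \<in> cactus k s m \<longleftrightarrow> j < m"
  "Side i b \<in> cactus k s m \<longleftrightarrow> i < k" "Far i \<in> cactus k s m \<longleftrightarrow> i < k" "Tip i \<in> cactus k s m \<longleftrightarrow> i < k"
  by (auto simp: cactus_def)

lemma sum_cactus:
  fixes f :: "vertex \<Rightarrow> 'a::comm_monoid_add"
  shows "sum f (cactus k s m) = f Hub + f Stem + (\<Sum>j<s. f (Twig j)) + (\<Sum>j<m. f (Bud j))
    + (\<Sum>i<k. f (Side i False)) + (\<Sum>i<k. f (Side i True)) + (\<Sum>i<k. f (Far i)) + (\<Sum>i<k. f (Tip i))"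
proof -
  have inj: "inj_on Twig A" "inj_on Bud A" "inj_on (\<lambda>i. Side i b) A" "inj_on Far A" "inj_on Tip A" for A b
    by (auto simp: inj_on_def)
  have disj: "sum f (A \<union> C) = sum f A + sum f C" if "finite A" "finite C" "\<forall>x\<in>A. x \<notin> C" for A C
    using that by (intro sum.union_disjoint) auto
  show ?thesis
    unfolding cactus_def
    by ((subst disj, simp, simp, force)+, simp add: sum.reindex[OF inj(1)] sum.reindex[OF inj(2)]
        sum.reindex[OF inj(3)] sum.reindex[OF inj(4)] sum.reindex[OF inj(5)] o_def)
qed

lemma card_cactus: "card (cactus k s m) = 2 + s + m + 4 * k"
  using sum_cactus[of "\<lambda>_. 1 :: nat" k s m] by simp

lemma green_sym: "green B u w = green B w u"
  by (cases u; cases w) auto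

section \<open>Green functions and Kirchhoff indices of the cactus\<close>

lemma adj_iff:
  "adj (Twig j) z \<longleftrightarrow> z = Hub"
  "adj Stem z \<longleftrightarrow> z \<in> insert Hub (range Bud)"
  "adj (Bud j) z \<longleftrightarrow> z = Stem"
  "adj (Side i b) z \<longleftrightarrow> z \<in> {Hub, Far i}"
  "adj (Far i) z \<longleftrightarrow> z \<in> {Side i False, Side i True, Tip i}"
  "adj (Tip i) z \<longleftrightarrow> z = Far i"
  by (cases z; auto simp: adj_def)+

lemma neighbours:
  "{z. z \<in> cactus k s m \<and> adj (Twig j) z} = {Hub}"
  "{z. z \<in> cactus k s m \<and> adj Stem z} = insert Hub (Bud ` {..<m})"
  "{z. z \<in> cactus k s m \<and> adj (Bud j) z} = {Stem}"
  "i < k \<Longrightarrow> {z. z \<in> cactus k s m \<and> adj (Side i b) z} = {Hub, Far i}"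
  "i < k \<Longrightarrow> {z. z \<in> cactus k s m \<and> adj (Far i) z} = {Side i False, Side i True, Tip i}"
  "i < k \<Longrightarrow> {z. z \<in> cactus k s m \<and> adj (Tip i) z} = {Far i}"
  unfolding adj_iff by auto

lemma sum_Bud: "(\<Sum>z\<in>insert Hub (Bud ` {..<m}). f z) = f Hub + (\<Sum>j<m. f (Bud j))"
  for f :: "vertex \<Rightarrow> real"
  by (subst sum.insert) (auto simp: sum.reindex inj_on_def)

text \<open>Branches at the hub do not interact, which explains the zero entries. On tree branches
  an entry counts the edges shared by the paths to the hub. On a four-cycle the diagonal entries
  \<open>3/4 = 1 * 3 / 4\<close> and \<open>1 = 2 * 2 / 4\<close> are resistances of two parallel
  paths to the hub, and the potential falls linearly along each path.\<close>

lemma green_function_cactus: "green_function (cactus k s m) adj Hub (green (\<lambda>_. False))"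
  unfolding green_function_def
proof (intro conjI ballI)
  fix u w assume u: "u \<in> cactus k s m - {Hub}" and w: "w \<in> cactus k s m"
  show "(\<Sum>z | z \<in> cactus k s m \<and> adj u z. green (\<lambda>_. False) u w - green (\<lambda>_. False) z w)
      = of_bool (u = w)"
  proof (cases u)
    case Stem
    show ?thesis unfolding Stem neighbours sum_Bud using w by (cases w) (auto simp: sum_negf)
  next
    case (Far i)
    show ?thesis using u w unfolding Far by (cases w) (auto simp: neighbours)
  qed (use u w in \<open>cases w; auto simp: neighbours\<close>)+
qed (auto intro: green_sym)

text \<open>The cut cycle has become a path of three edges from the hub, so its entries count shared
  edges.\<close>

lemma green_function_cactus_delete:
  assumes i: "i < k"
  shows "green_function (cactus k s m - {Side i b}) adj Hub (green (\<lambda>j. j = i))"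
  unfolding green_function_def
proof (intro conjI ballI)
  fix u w assume u: "u \<in> cactus k s m - {Side i b} - {Hub}" and w: "w \<in> cactus k s m - {Side i b}"
  let ?V = "cactus k s m - {Side i b}"
  have nb: "{z. z \<in> ?V \<and> adj u z} = {z. z \<in> cactus k s m \<and> adj u z} - {Side i b}"
    by auto
  show "(\<Sum>z | z \<in> ?V \<and> adj u z. green (\<lambda>j. j = i) u w - green (\<lambda>j. j = i) z w) = of_bool (u = w)"
  proof (cases u)
    case (Twig j)
    have "{z. z \<in> ?V \<and> adj u z} = {Hub}" unfolding nb unfolding Twig neighbours by auto
    thus ?thesis using w Twig by (cases w) auto
  next
    case Stem
    have "{z. z \<in> ?V \<and> adj u z} = insert Hub (Bud ` {..<m})"
      unfolding nb unfolding Stem neighbours by auto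
    thus ?thesis using w Stem by (cases w) (auto simp: sum_Bud sum_negf)
  next
    case (Bud j)
    have "{z. z \<in> ?V \<and> adj u z} = {Stem}" unfolding nb unfolding Bud neighbours by auto
    thus ?thesis using w u Bud by (cases w) auto
  next
    case (Side j c)
    hence j: "j < k" using u by simp
    have "{z. z \<in> ?V \<and> adj u z} = {Hub, Far j}" unfolding nb unfolding Side neighbours(4)[OF j] by auto
    thus ?thesis using w u Side by (cases w) auto
  next
    case (Far j)
    hence j: "j < k" using u by simp
    have "{z. z \<in> ?V \<and> adj u z}
        = (if j = i then {Side i (\<not> b), Tip i} else {Side j True, Side j False, Tip j})"
      unfolding nb unfolding Far neighbours(5)[OF j] by (cases b) auto
    thus ?thesis using w Far by (cases w) auto
  next
    case (Tip j)
    hence j: "j < k" using u by simp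
    have "{z. z \<in> ?V \<and> adj u z} = {Far j}" unfolding nb unfolding Tip neighbours(6)[OF j] by auto
    thus ?thesis using w Tip by (cases w) auto
  qed (use u in auto)
qed (auto intro: green_sym)

text \<open>The sums run over the full cactus, so on a cut cycle they include the deleted side. The
  entry of \<open>green\<close> there is \<open>1\<close> against each vertex of that cycle, which
  is subtracted later.\<close>

lemma green_rows:
  "u \<in> cactus k s m \<Longrightarrow> (\<Sum>w\<in>cactus k s m. green B u w) =
    (case u of Hub \<Rightarrow> 0 | Stem \<Rightarrow> 1 + real m | Twig _ \<Rightarrow> 1 | Bud _ \<Rightarrow> 2 + real m
      | Side i _ \<Rightarrow> if B i then 4 else 2 | Far i \<Rightarrow> if B i then 6 else 3 | Tip i \<Rightarrow> if B i then 7 else 4)"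
  by (cases u) (auto simp: sum_cactus sum.distrib)

text \<open>Each four-cycle adds \<open>3/4 + 3/4 + 1 + 2 = 9/2\<close> to the trace and
  \<open>2 + 2 + 3 + 4 = 11\<close> to the sum of entries.\<close>

lemma kirchhoff_index_cactus:
  "kirchhoff_index (graph_of (cactus k s m) adj)
    = (2 + real s + real m + 4 * real k) * (1 + real s + 2 * real m + 9/2 * real k)
      - (1 + real m + real s + real m * (2 + real m) + 11 * real k)"
proof -
  have "(\<Sum>u\<in>cactus k s m. green (\<lambda>_. False) u u) = 1 + real s + 2 * real m + 9/2 * real k"
    by (simp add: sum_cactus)
  moreover have "(\<Sum>u\<in>cactus k s m. \<Sum>w\<in>cactus k s m. green (\<lambda>_. False) u w)
      = 1 + real m + real s + real m * (2 + real m) + 11 * real k"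
    by (simp add: green_rows cong: sum.cong) (simp add: sum_cactus)
  ultimately show ?thesis
    using kirchhoff_index_green[OF finite_cactus symp_adj adj_irrefl green_function_cactus]
    by (simp add: card_cactus)
qed

text \<open>The cut cycle has trace \<open>1 + 2 + 3 = 6\<close> in place of \<open>9/2\<close> and
  entry sum \<open>3 + 5 + 6 = 14\<close> in place of \<open>11\<close>.\<close>

lemma kirchhoff_index_cactus_delete:
  assumes i: "i < k"
  shows "kirchhoff_index (graph_of (cactus k s m - {Side i b}) adj)
    = (1 + real s + real m + 4 * real k) * (1 + real s + 2 * real m + 9/2 * real k + 3/2)
      - (1 + real m + real s + real m * (2 + real m) + 11 * real k + 3)"
proof -
  let ?V = "cactus k s m - {Side i b}" and ?g = "green (\<lambda>j. j = i)"
  have S: "sum f ?V = sum f (cactus k s m) - f (Side i b)" for f :: "vertex \<Rightarrow> real"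
    using i by (simp add: sum_diff1)
  have delta: "(\<Sum>j<k. if j = i then x else y) = real k * y + (x - y)" for x y :: real
  proof -
    have "(\<Sum>j<k. if j = i then x else y) = (\<Sum>j<k. (if j = i then x - y else 0) + y)"
      by (intro sum.cong) auto
    thus ?thesis using i by (simp add: sum.distrib)
  qed
  have "(\<Sum>u\<in>?V. ?g u u) = 1 + real s + 2 * real m + 9/2 * real k + 3/2"
    unfolding S sum_cactus by (simp add: delta)
  moreover have "(\<Sum>u\<in>?V. \<Sum>w\<in>?V. ?g u w)
      = 1 + real m + real s + real m * (2 + real m) + 11 * real k + 3"
  proof -
    have "(\<Sum>u\<in>?V. \<Sum>w\<in>?V. ?g u w)
        = (\<Sum>u\<in>?V. case u of Hub \<Rightarrow> 0 | Stem \<Rightarrow> 1 + real m | Twig _ \<Rightarrow> 1 | Bud _ \<Rightarrow> 2 + real m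
      | Side j _ \<Rightarrow> if j = i then 3 else 2 | Far j \<Rightarrow> if j = i then 5 else 3 | Tip j \<Rightarrow> if j = i then 6 else 4)"
      unfolding S[of "?g _"] by (intro sum.cong refl) (auto simp: green_rows split: vertex.splits)
    also have "\<dots> = 1 + real m + real s + real m * (2 + real m) + 11 * real k + 3"
      unfolding S sum_cactus by (simp add: delta)
    finally show ?thesis .
  qed
  moreover have "card ?V = 1 + s + m + 4 * k"
    using i by (simp add: card_cactus)
  ultimately show ?thesis
    using kirchhoff_index_green[OF _ symp_adj adj_irrefl green_function_cactus_delete[OF i]]
    by simp
qed

section \<open>Connectedness and the characterisation of good vertices\<close>

lemma connected_cactus: "Digraph_Component.connected (graph_of (cactus k s m) adj)"
proof (rule connected_graph_ofI[where c = Hub and rank = depth])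
  fix u assume "u \<in> cactus k s m" "u \<noteq> Hub"
  thus "\<exists>z\<in>cactus k s m. adj u z \<and> depth z < depth u"
  proof (cases u)
    case (Far i)
    thus ?thesis using \<open>u \<in> _\<close> by (intro bexI[of _ "Side i True"]) (auto simp: adj_def)
  next
    case (Tip i)
    thus ?thesis using \<open>u \<in> _\<close> by (intro bexI[of _ "Far i"]) (auto simp: adj_def)
  next
    case (Bud i)
    thus ?thesis by (intro bexI[of _ Stem]) (auto simp: adj_def)
  qed (auto simp: adj_def intro!: bexI[of _ Hub])
qed (auto simp: symp_adj adj_irrefl)

lemma connected_cactus_delete:
  "Digraph_Component.connected (graph_of (cactus k s m - {Side i b}) adj)"
proof (rule connected_graph_ofI[where c = Hub and rank = depth])
  fix u assume "u \<in> cactus k s m - {Side i b}" "u \<noteq> Hub"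
  thus "\<exists>z\<in>cactus k s m - {Side i b}. adj u z \<and> depth z < depth u"
  proof (cases u)
    case (Far j)
    \<comment> \<open>The side opposite to \<open>b\<close> survives in every cycle, also in the cut
      one.\<close>
    thus ?thesis using \<open>u \<in> _\<close> by (intro bexI[of _ "Side j (\<not> b)"]) (auto simp: adj_def)
  next
    case (Tip j)
    thus ?thesis using \<open>u \<in> _\<close> by (intro bexI[of _ "Far j"]) (auto simp: adj_def)
  next
    case (Bud j)
    thus ?thesis by (intro bexI[of _ Stem]) (auto simp: adj_def)
  qed (auto simp: adj_def intro!: bexI[of _ Hub])
qed (auto simp: symp_adj adj_irrefl)

text \<open>The equation for \<open>m\<close> is stated additively because of truncated subtraction.
  Positivity of \<open>k\<close> and \<open>m\<close> supplies a cycle that the hub separates from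
  the stem and a bud that the stem separates from the hub.\<close>

lemma good_vertex_cactus_iff:
  assumes m: "m + 5 = s + 3 * k" and pos: "0 < m" "0 < k" and v: "v \<in> cactus k s m"
  shows "good_vertex (graph_of (cactus k s m) adj) (to_nat v) \<longleftrightarrow> (\<exists>i b. v = Side i b)"
proof -
  let ?V = "cactus k s m"
  have good: "good_vertex (graph_of ?V adj) (to_nat v) \<longleftrightarrow>
      Digraph_Component.connected (graph_of (?V - {v}) adj) \<and>
      kirchhoff_index (graph_of ?V adj) = kirchhoff_index (graph_of (?V - {v}) adj)"
    using v by (simp add: good_vertex_def del_vert_graph_of)
  have cut: "\<not> good_vertex (graph_of ?V adj) (to_nat v)"
    if "a \<in> U" "a \<in> ?V - {v}" "b \<in> ?V - {v}" "b \<notin> U"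
      "\<And>u z. u \<in> U \<Longrightarrow> z \<in> ?V - {v} \<Longrightarrow> adj u z \<Longrightarrow> z \<in> U" for a b U
    using not_connected_graph_ofI[OF _ symp_adj adj_irrefl that] good by simp
  have trace: "(\<Sum>u\<in>?V. green (\<lambda>_. False) u u) \<ge> 0"
    by (simp add: sum_cactus)
  \<comment> \<open>As the trace is nonnegative, this inequality makes the Kirchhoff index drop
    strictly when the leaf is deleted.\<close>
  have leaf: "\<not> good_vertex (graph_of ?V adj) (to_nat v)"
    if "{z. z \<in> ?V \<and> adj v z} = {p}" "v \<noteq> Hub"
      "real (card ?V) * green (\<lambda>_. False) v v > 2 * (\<Sum>w\<in>?V. green (\<lambda>_. False) v w)" for p
    using kirchhoff_index_delete_leaf[OF finite_cactus symp_adj adj_irrefl green_function_cactus v that(2,1)]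
      that(3) trace good by auto
  show ?thesis
  proof (cases v)
    case Hub
    have "\<not> good_vertex (graph_of ?V adj) (to_nat v)"
    proof (rule cut[of Stem "insert Stem (range Bud)" "Far 0"])
      fix u z assume "u \<in> insert Stem (range Bud)" "z \<in> ?V - {v}" "adj u z"
      thus "z \<in> insert Stem (range Bud)" using Hub by (cases z) (auto simp: adj_def)
    qed (use Hub pos in auto)
    thus ?thesis using Hub by simp
  next
    case Stem
    have "\<not> good_vertex (graph_of ?V adj) (to_nat v)"
    proof (rule cut[of "Bud 0" "range Bud" Hub])
      fix u z assume "u \<in> range Bud" "z \<in> ?V - {v}" "adj u z"
      thus "z \<in> range Bud" using Stem by (cases z) (auto simp: adj_def)
    qed (use Stem pos in auto)
    thus ?thesis using Stem by simp
  next
    case (Far i)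
    have "\<not> good_vertex (graph_of ?V adj) (to_nat v)"
    proof (rule cut[of "Tip i" "{Tip i}" Hub])
      fix u z assume "u \<in> {Tip i}" "z \<in> ?V - {v}" "adj u z"
      thus "z \<in> {Tip i}" using Far by (cases z) (auto simp: adj_def)
    qed (use Far v in auto)
    thus ?thesis using Far by simp
  next
    case (Side i b)
    have m': "real m = real s + 3 * real k - 5" using m by linarith
    have "kirchhoff_index (graph_of ?V adj) = kirchhoff_index (graph_of (?V - {v}) adj)"
      unfolding Side using v Side
      by (subst kirchhoff_index_cactus_delete) (auto simp: kirchhoff_index_cactus m' algebra_simps)
    thus ?thesis using good connected_cactus_delete Side by auto
  next
    case (Twig j)
    have "\<not> good_vertex (graph_of ?V adj) (to_nat v)"
      using v Twig pos by (intro leaf[of Hub]) (auto simp: neighbours green_rows card_cactus)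
    thus ?thesis using Twig by simp
  next
    case (Bud j)
    have "\<not> good_vertex (graph_of ?V adj) (to_nat v)"
      using v Bud pos by (intro leaf[of Stem]) (auto simp: neighbours green_rows card_cactus)
    thus ?thesis using Bud by simp
  next
    case (Tip i)
    have "\<not> good_vertex (graph_of ?V adj) (to_nat v)"
      using v Tip pos by (intro leaf[of "Far i"]) (auto simp: neighbours green_rows card_cactus)
    thus ?thesis using Tip by simp
  qed
qed

section \<open>The sequence of graphs and the limit of the proportions\<close>

lemma card_good_vertices_cactus:
  assumes "m + 5 = s + 3 * k" "0 < m" "0 < k"
  shows "card (good_vertices (graph_of (cactus k s m) adj)) = 2 * k"
proof -
  have "good_vertices (graph_of (cactus k s m) adj)
      = (\<lambda>(i, b). to_nat (Side i b)) ` ({..<k} \<times> UNIV)"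
  proof (intro set_eqI iffI)
    fix x assume x: "x \<in> good_vertices (graph_of (cactus k s m) adj)"
    then obtain v where v: "v \<in> cactus k s m" "x = to_nat v"
      by (auto simp: good_vertices_def good_vertex_def)
    then obtain i b where "v = Side i b"
      using x good_vertex_cactus_iff[OF assms] by (auto simp: good_vertices_def)
    thus "x \<in> (\<lambda>(i, b). to_nat (Side i b)) ` ({..<k} \<times> UNIV)" using v by auto
  next
    fix x assume "x \<in> (\<lambda>(i, b). to_nat (Side i b)) ` ({..<k} \<times> (UNIV :: bool set))"
    then obtain i b where "x = to_nat (Side i b)" "i < k" by auto
    thus "x \<in> good_vertices (graph_of (cactus k s m) adj)"
      using good_vertex_cactus_iff[OF assms, of "Side i b"] by (auto simp: good_vertices_def)
  qed
  moreover have "inj_on (\<lambda>(i, b). to_nat (Side i b)) ({..<k} \<times> (UNIV :: bool set))"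
    by (auto simp: inj_on_def)
  ultimately show ?thesis by (simp add: card_image card_cartesian_product)
qed

lemma digraph_iso_card_verts:
  assumes "digraph_iso G H"
  shows "card (verts G) = card (verts H)"
proof -
  obtain f where "pre_digraph.digraph_isomorphism G f" "H = app_iso f G"
    using assms by (auto simp: digraph_iso_def)
  thus ?thesis
    using pre_digraph.digraph_isomorphism_inj_on_verts by (auto simp: card_image)
qed

theorem theorem10:
  shows "\<exists>(G :: nat \<Rightarrow> (nat, nat \<times> nat) pre_digraph) (\<beta> :: nat \<Rightarrow> real).
    (\<forall>k. connected_graph (G k)) \<and>
    (\<forall>i j. i \<noteq> j \<longrightarrow> \<not> digraph_iso (G i) (G j)) \<and>
    (\<forall>k. \<beta> k = real (card (good_vertices (G k))) / real (card (verts (G k)))) \<and>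
    (\<forall>k. 0 < \<beta> k) \<and>
    (\<forall>k. kirchhoff_soltes (\<beta> k) (G k)) \<and>
    \<beta> \<longlonglongrightarrow> 3 - 2 * sqrt 2"
proof -
  \<comment> \<open>There are \<open>k = n + 2\<close> cycles, so that
    \<open>m = s + 3 * k - 5\<close> becomes \<open>s + 3 * n + 1\<close> and is positive. The
    factor before \<open>real n + 2\<close> is the required limit of \<open>s/k\<close>.\<close>
  define s where "s n = nat \<lfloor>(2 * sqrt 2 - 1/2) * (real n + 2)\<rfloor>" for n
  define m where "m n = s n + 3 * n + 1" for n
  define G where "G n = graph_of (cactus (n + 2) (s n) (m n)) adj" for n
  define \<beta> where "\<beta> n = real (card (good_vertices (G n))) / real (card (verts (G n)))" for n
  have good: "card (good_vertices (G n)) = 2 * (n + 2)" for n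
    unfolding G_def by (rule card_good_vertices_cactus) (auto simp: m_def)
  have verts: "card (verts (G n)) = 2 * s n + 7 * n + 11" for n
  proof -
    have "card (verts (G n)) = card (cactus (n + 2) (s n) (m n))"
      unfolding G_def verts_graph_of by (intro card_image inj_on_subset[OF inj_to_nat]) simp
    thus ?thesis by (simp add: card_cactus m_def)
  qed
  have conn: "connected_graph (G n)" for n
    unfolding connected_graph_def G_def
    by (simp add: graph_graph_of symp_adj adj_irrefl connected_cactus)
  have \<beta>: "\<beta> n = 2 * (real n + 2) / (2 * real (s n) + 7 * real n + 11)" for n
    unfolding \<beta>_def good verts by simp
  have "sqrt 2 > 1" by simp
  hence pos: "2 * sqrt 2 - 1/2 > 0" by linarith
  \<comment> \<open>Graphs of different orders are not isomorphic; the order grows strictly since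
    \<open>s\<close> is monotone.\<close>
  have "strict_mono (\<lambda>n. card (verts (G n)))"
  unfolding strict_mono_Suc_iff
  proof
    fix n
    have "(2 * sqrt 2 - 1/2) * (real n + 2) \<le> (2 * sqrt 2 - 1/2) * (real (Suc n) + 2)"
      using pos by (intro mult_left_mono) auto
    hence "s n \<le> s (Suc n)" unfolding s_def by (intro nat_mono floor_mono)
    thus "card (verts (G n)) < card (verts (G (Suc n)))" by (simp add: verts)
  qed
  hence iso: "\<not> digraph_iso (G i) (G j)" if "i \<noteq> j" for i j
    using that digraph_iso_card_verts strict_mono_eq by metis
  have soltes: "kirchhoff_soltes (\<beta> n) (G n)" for n
    unfolding kirchhoff_soltes_def
  proof (intro conjI)
    show "\<beta> n \<in> \<rat>" unfolding \<beta>_def by simp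
    show "0 < \<beta> n" "\<beta> n \<le> 1" unfolding \<beta> by (auto simp: field_simps)
    show "\<beta> n * real (card (verts (G n))) \<le> real (card (good_vertices (G n)))"
      unfolding \<beta>_def by simp
  qed (rule conn)
  have s_real: "real (s n) = of_int \<lfloor>(2 * sqrt 2 - 1/2) * (real n + 2)\<rfloor>" for n
    using pos unfolding s_def by simp
  define c :: real where "c = 2 * sqrt 2 - 1/2"
  have "c > 0" using pos by (simp add: c_def)
  hence "(\<lambda>n. 2 * (real n + 2) / (2 * of_int \<lfloor>c * (real n + 2)\<rfloor> + 7 * real n + 11))
      \<longlonglongrightarrow> 2 * inverse (2 * c + 7)"
    by real_asymp
  \<comment> \<open>Here \<open>2 * c + 7 = 6 + 4 * sqrt 2\<close>, which is twice the conjugate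
    \<open>3 + 2 * sqrt 2\<close> of the limit.\<close>
  moreover have "2 * inverse (2 * c + 7) = 3 - 2 * sqrt 2"
  proof -
    have "(2 * c + 7) * (3 - 2 * sqrt 2) = 2" by (simp add: c_def algebra_simps)
    thus ?thesis using \<open>c > 0\<close> by (simp add: field_simps)
  qed
  ultimately have "\<beta> \<longlonglongrightarrow> 3 - 2 * sqrt 2"
    unfolding \<beta> s_real c_def by simp
  thus ?thesis using conn iso \<beta>_def soltes unfolding kirchhoff_soltes_def by blast
qed

end
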